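(* Let $p$ be an odd prime, let $s,t$ be integers with $1 \le s,t \le p-1$, and let $A,B$ be subsets of $\mathbb{Z}_p$ with $|A|=s$, $|B|=t$. Define \[ f(s,t) = \begin{cases} 0 & \text{if } 2t \le p-s+1,\\ \left\lfloor \frac{(s+2t-p)^2}{4}\right\rfloor & \text{if } p-s+2 \le 2t \le p+s-2,\\ s(2t-p) & \text{if } p+s-1 \le 2t,\end{cases} \qquad g(s,t) = \begin{cases} t^2 & \text{if } 2t \le s,\\ \left\lceil \frac{s(4t-s)}{4}\right\rceil & \text{if } s+1 \le 2t \le 2p-s-1,\\ s(2t-p)+(p-t)^2 & \text{if } 2p-s \le 2t.\end{cases} \] Then $f(s,t) \le r(A,B,B) \le g(s,t)$.
   Context: $\mathbb{Z}_p$ is the additive group of integers modulo $p$. $r(A,B,B)$ denotes the number of triples $(a,b,a+b)$ with $a\in A$, $b\in B$ and $a+b\in B$. *)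

theory Defs
  imports Complex_Main "HOL-Number_Theory.Residues"
begin

definition triple_count :: "('a, 'b) ring_scheme \<Rightarrow> 'a set \<Rightarrow> 'a set \<Rightarrow> 'a set \<Rightarrow> nat" where
  "triple_count R A B C =
    card {(a, b, a \<oplus>\<^bsub>R\<^esub> b) | a b. a \<in> A \<and> b \<in> B \<and> a \<oplus>\<^bsub>R\<^esub> b \<in> C}"

(* In both bounds the final else-branch is exactly the remaining range,
   p + s - 1 \<le> 2 * t and 2 * p - s \<le> 2 * t respectively: for odd p and
   1 \<le> s \<le> p - 1 the three ranges are disjoint and cover all integers t. *)

definition lower_bound :: "int \<Rightarrow> int \<Rightarrow> int \<Rightarrow> int" where
  "lower_bound p s t =
    (if 2 * t \<le> p - s + 1 then 0
     else if p - s + 2 \<le> 2 * t \<and> 2 * t \<le> p + s - 2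
       then \<lfloor>real_of_int ((s + 2 * t - p)^2) / 4\<rfloor>
     else s * (2 * t - p))"

definition upper_bound :: "int \<Rightarrow> int \<Rightarrow> int \<Rightarrow> int" where
  "upper_bound p s t =
    (if 2 * t \<le> s then t^2
     else if s + 1 \<le> 2 * t \<and> 2 * t \<le> 2 * p - s - 1
       then \<lceil>real_of_int (s * (4 * t - s)) / 4\<rceil>
     else s * (2 * t - p) + (p - t)^2)"

end

(* Write r(x) for the number of pairs (b, b') in B x B with b - b' = x, so that r(A,B,B) is the
   sum of r over A. Pollard's theorem, proved by the e-transform, says that the sum of min k (r x)
   over all x is at least k * min p (2t - k) for k \<le> t. Over A each min k (r x) is at most k and the
   sum of r over the whole group is t^2, which gives the upper bound; over the complement of A
   each min k (r x) is again at most k, which gives the lower bound. The best choices of k are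
   (2t - s)/2 above and (s + 2t - p)/2 below, rounded down and then raised to max 0 (2t - p)
   if they lie below it. *)

theory Submission
  imports Defs
begin

section \<open>Representation counts in a commutative group\<close>

definition rep_count :: "('a, 'b) monoid_scheme \<Rightarrow> 'a set \<Rightarrow> 'a set \<Rightarrow> 'a \<Rightarrow> nat" where
  "rep_count G A B x = card {(a, b) \<in> A \<times> B. a \<otimes>\<^bsub>G\<^esub> b = x}"

lemma finite_rep_pairs:
  "finite A \<Longrightarrow> finite B \<Longrightarrow> finite {(a, b) \<in> A \<times> B. f a b = x}"
  by (rule finite_subset[of _ "A \<times> B"]) auto

lemma rep_count_disjoint_union_left:
  assumes "finite A" "finite A'" "finite B" "A \<inter> A' = {}"
  shows "rep_count G (A \<union> A') B x = rep_count G A B x + rep_count G A' B x"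
proof -
  have *: "{(a, b) \<in> (A \<union> A') \<times> B. a \<otimes>\<^bsub>G\<^esub> b = x}
      = {(a, b) \<in> A \<times> B. a \<otimes>\<^bsub>G\<^esub> b = x} \<union> {(a, b) \<in> A' \<times> B. a \<otimes>\<^bsub>G\<^esub> b = x}"
    by auto
  show ?thesis
    unfolding rep_count_def *
    by (intro card_Un_disjoint finite_rep_pairs assms(1-3)) (use assms(4) in auto)
qed

lemma rep_count_mono:
  assumes "finite A" "finite B" "A' \<subseteq> A"
  shows "rep_count G A' B x \<le> rep_count G A B x"
  unfolding rep_count_def using assms
  by (intro card_mono finite_rep_pairs) auto

context comm_group
begin

lemma rep_count_commute:
  assumes "A \<subseteq> carrier G" "B \<subseteq> carrier G"
  shows "rep_count G A B x = rep_count G B A x"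
  unfolding rep_count_def
  by (rule bij_betw_same_card[of prod.swap], rule bij_betw_byWitness[where f' = prod.swap])
    (use assms in \<open>auto simp: subset_iff intro!: m_comm\<close>)

lemma rep_count_le_card:
  assumes "A \<subseteq> carrier G" "B \<subseteq> carrier G" "finite B"
  shows "rep_count G A B x \<le> card B"
  unfolding rep_count_def
  by (rule card_inj_on_le[of snd]) (use assms in \<open>auto simp: inj_on_def subset_iff\<close>)

text \<open>With \<open>I = A \<inter> B\<close>, cut \<open>A\<close> and \<open>B\<close> into
  \<open>I\<close> and remainders \<open>A'\<close> and \<open>B'\<close>. Of the four blocks of
  pairs, \<open>I * I\<close>, \<open>A' * I\<close> and, after swapping the factors,
  \<open>I * B'\<close> make up \<open>(A \<union> B) * I\<close>; only \<open>A' * B'\<close> is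
  left over.\<close>

lemma rep_count_Un_Int:
  assumes "A \<subseteq> carrier G" "B \<subseteq> carrier G" "finite A" "finite B"
  shows "rep_count G A B x
    = rep_count G (A \<union> B) (A \<inter> B) x + rep_count G (A - A \<inter> B) (B - A \<inter> B) x"
proof -
  let ?I = "A \<inter> B" and ?A = "A - A \<inter> B" and ?B = "B - A \<inter> B"
  have fin: "finite ?I" "finite ?A" "finite ?B" using assms by auto
  have car: "?I \<subseteq> carrier G" "?A \<subseteq> carrier G" "?B \<subseteq> carrier G" using assms by auto
  have "rep_count G A B x = rep_count G (?I \<union> ?B) A x"
  proof -
    have "?I \<union> ?B = B" by auto
    then show ?thesis by (simp only: rep_count_commute[OF assms(1,2)])
  qed
  also have "\<dots> = rep_count G ?I A x + rep_count G ?B A x"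
    by (rule rep_count_disjoint_union_left) (use assms in auto)
  also have "rep_count G ?I A x = rep_count G A ?I x"
    by (rule rep_count_commute[OF car(1) assms(1)])
  also have "rep_count G ?B A x = rep_count G A ?B x"
    by (rule rep_count_commute[OF car(3) assms(1)])
  also have "\<dots> = rep_count G (?I \<union> ?A) ?B x"
  proof -
    have "?I \<union> ?A = A" by auto
    then show ?thesis by (simp only:)
  qed
  also have "\<dots> = rep_count G ?I ?B x + rep_count G ?A ?B x"
    by (rule rep_count_disjoint_union_left) (use fin in auto)
  also have "rep_count G ?I ?B x = rep_count G ?B ?I x"
    by (rule rep_count_commute[OF car(1,3)])
  also have "rep_count G A ?I x + (rep_count G ?B ?I x + rep_count G ?A ?B x)
      = rep_count G (A \<union> ?B) ?I x + rep_count G ?A ?B x"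
    using rep_count_disjoint_union_left[OF assms(3) fin(3,1), of G x]
    by (simp add: disjoint_iff)
  also have "A \<union> ?B = A \<union> B" by auto
  finally show ?thesis .
qed

lemma sum_rep_count:
  assumes "A \<subseteq> carrier G" "B \<subseteq> carrier G" "finite (carrier G)"
  shows "(\<Sum>x\<in>carrier G. rep_count G A B x) = card A * card B"
proof -
  have fin: "finite A" "finite B" using assms finite_subset by blast+
  have "A \<times> B = (\<Union>x\<in>carrier G. {(a, b) \<in> A \<times> B. a \<otimes> b = x})"
    using assms by (auto intro!: m_closed)
  then have "card (A \<times> B) = card (\<Union>x\<in>carrier G. {(a, b) \<in> A \<times> B. a \<otimes> b = x})"
    by (rule arg_cong)
  also have "\<dots> = (\<Sum>x\<in>carrier G. card {(a, b) \<in> A \<times> B. a \<otimes> b = x})"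
    by (rule card_UN_disjoint) (use assms finite_rep_pairs[OF fin] in auto)
  finally show ?thesis by (simp add: rep_count_def card_cartesian_product)
qed

lemma rep_count_translate:
  assumes "A \<subseteq> carrier G" "B \<subseteq> carrier G" "e \<in> carrier G" "x \<in> carrier G"
  shows "rep_count G A ((\<lambda>b. b \<otimes> e) ` B) (x \<otimes> e) = rep_count G A B x"
proof -
  have eq: "a \<otimes> (b \<otimes> e) = x \<otimes> e \<longleftrightarrow> a \<otimes> b = x" if "a \<in> A" "b \<in> B" for a b
  proof -
    have "a \<in> carrier G" "b \<in> carrier G" using that assms by auto
    then show ?thesis
      using assms(3,4) right_cancel[of e "a \<otimes> b" x] by (simp add: m_assoc)
  qed
  have "bij_betw (\<lambda>(a, b). (a, b \<otimes> e)) {(a, b) \<in> A \<times> B. a \<otimes> b = x}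
      {(a, b) \<in> A \<times> (\<lambda>b. b \<otimes> e) ` B. a \<otimes> b = x \<otimes> e}"
    by (rule bij_betw_byWitness[where f' = "\<lambda>(a, c). (a, c \<otimes> inv e)"])
      (use eq assms in \<open>auto simp: m_assoc subset_iff\<close>)
  then show ?thesis
    unfolding rep_count_def using bij_betw_same_card by fastforce
qed

text \<open>Translating \<open>B\<close> by \<open>e\<close> merely shifts the counts by
  \<open>e\<close>. The function \<open>f\<close> is arbitrary so that truncation by
  \<open>min t\<close> is covered.\<close>

lemma sum_rep_count_translate:
  assumes "A \<subseteq> carrier G" "B \<subseteq> carrier G" "e \<in> carrier G"
  shows "(\<Sum>x\<in>carrier G. f (rep_count G A ((\<lambda>b. b \<otimes> e) ` B) x))
    = (\<Sum>x\<in>carrier G. f (rep_count G A B x))"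
proof (rule sum.reindex_bij_witness[where i = "\<lambda>x. x \<otimes> e" and j = "\<lambda>x. x \<otimes> inv e"])
  fix x assume x: "x \<in> carrier G"
  then show "f (rep_count G A B (x \<otimes> inv e)) = f (rep_count G A ((\<lambda>b. b \<otimes> e) ` B) x)"
    using rep_count_translate[OF assms, of "x \<otimes> inv e"] assms(3) by (simp add: m_assoc)
qed (use assms in \<open>auto simp: m_assoc\<close>)

section \<open>Pollard's theorem in groups of prime order\<close>

text \<open>The order of \<open>d\<close> divides a prime and is not 1, so \<open>d\<close>
  generates the group. Closure then puts the whole coset of powers
  \<open>a \<otimes> d [^] n\<close> into \<open>A\<close>.\<close>

lemma prime_order_closed_imp_carrier:
  assumes "finite (carrier G)" "prime (order G)" "A \<subseteq> carrier G" "A \<noteq> {}"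
    and "d \<in> carrier G" "d \<noteq> \<one>" and closed: "\<And>a. a \<in> A \<Longrightarrow> a \<otimes> d \<in> A"
  shows "A = carrier G"
proof -
  obtain a where a: "a \<in> A" using assms by blast
  have pow: "a \<otimes> d [^] (n::nat) \<in> A" for n
  proof (induction n)
    case (Suc n)
    have "a \<in> carrier G" using a assms by auto
    then show ?case using closed[OF Suc] assms(5) by (simp add: m_assoc)
  qed (use a assms in auto)
  have "ord d dvd order G" using ord_dvd_group_order assms by blast
  moreover have "ord d \<noteq> 1" using assms ord_eq_1 by blast
  ultimately have "ord d = order G" using assms by (metis prime_nat_iff)
  then have "card (generate G {d}) = card (carrier G)"
    using generate_pow_card assms by (simp add: order_def)
  moreover have "generate G {d} \<subseteq> carrier G" using generate_incl assms by simp
  ultimately have gen: "generate G {d} = carrier G"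
    using assms card_subset_eq by blast
  show ?thesis
  proof
    show "carrier G \<subseteq> A"
    proof
      fix x assume x: "x \<in> carrier G"
      then have "inv a \<otimes> x \<in> generate G {d}" using gen a assms by auto
      then obtain n :: nat where "inv a \<otimes> x = d [^] n"
        using generate_pow_on_finite_carrier assms by auto
      then have "a \<otimes> d [^] n = x" using x a assms
        by (metis inv_solve_left nat_pow_closed subsetD)
      then show "x \<in> A" using pow by metis
    qed
  qed (use assms in auto)
qed

text \<open>For distinct \<open>b\<close>, \<open>c\<close> in \<open>B\<close> the quotient
  \<open>c \<otimes> inv b\<close> is nontrivial, so multiplication by it leads some
  \<open>a\<close> in \<open>A\<close> out of \<open>A\<close>. Translation by
  \<open>a \<otimes> inv b\<close> sends \<open>b\<close> to \<open>a\<close> and \<open>c\<close>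
  to that outside point.\<close>

lemma ex_translate_meets_not_subset:
  assumes "finite (carrier G)" "prime (order G)" "A \<subseteq> carrier G" "A \<noteq> {}" "A \<noteq> carrier G"
    and "B \<subseteq> carrier G" "card B \<ge> 2"
  obtains e where "e \<in> carrier G" "A \<inter> (\<lambda>b. b \<otimes> e) ` B \<noteq> {}" "\<not> (\<lambda>b. b \<otimes> e) ` B \<subseteq> A"
proof -
  obtain b c where bc: "b \<in> B" "c \<in> B" "b \<noteq> c"
    using assms(7) card_le_Suc0_iff_eq[of B] by (metis card.infinite not_less_eq_eq numeral_2_eq_2 zero_le)
  have car: "b \<in> carrier G" "c \<in> carrier G" using bc assms by auto
  have "c \<otimes> inv b \<noteq> \<one>" using bc car by (metis inv_closed inv_equality inv_inv)
  then obtain a where a: "a \<in> A" "a \<otimes> (c \<otimes> inv b) \<notin> A"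
    using prime_order_closed_imp_carrier[of A "c \<otimes> inv b"] assms car by auto
  have acar: "a \<in> carrier G" using a assms by auto
  have 1: "b \<otimes> (a \<otimes> inv b) = a" using car acar m_comm m_assoc by (simp add: inv_solve_left m_lcomm)
  have 2: "c \<otimes> (a \<otimes> inv b) = a \<otimes> (c \<otimes> inv b)" using car acar by (simp add: m_lcomm)
  show thesis
    by (rule that[of "a \<otimes> inv b"])
      (use 1 2 a bc car acar in \<open>auto simp: image_iff disjoint_iff\<close>, metis+)
qed

text \<open>After a translation, the e-transform replaces \<open>(A, B)\<close> by \<open>(A \<union> B, A \<inter> B)\<close>. If
  \<open>t > card (A \<inter> B)\<close>, this pair contributes all of its sums, and the induction hypothesis is applied
  to \<open>A - B\<close> and \<open>B - A\<close> with \<open>t - card (A \<inter> B)\<close> instead.\<close>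

lemma Pollard_aux:
  assumes "finite (carrier G)" "prime (order G)" "A \<subseteq> carrier G" "B \<subseteq> carrier G"
    and "t \<le> card A" "t \<le> card B" "card A + card B \<le> order G + t"
  shows "t * (card A + card B - t) \<le> (\<Sum>x\<in>carrier G. min t (rep_count G A B x))"
  using assms(3-7)
proof (induction "card B" arbitrary: A B t rule: less_induct)
  case less
  note fin = finite_subset[OF _ assms(1)]
  consider "t = 0" | "t = card B" | "t > 0" "t < card B" using less.prems by linarith
  then show ?case
  proof cases
    \<comment> \<open>No count exceeds \<open>card B = t\<close>, so truncation changes nothing and
      equality holds.\<close>
    case 2
    have "min t (rep_count G A B x) = rep_count G A B x" for x
      using rep_count_le_card[of A B x] less.prems fin 2 by simp
    then show ?thesis
      using sum_rep_count[OF less.prems(1,2) assms(1)] 2 by simp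
  next
    case 3
    \<comment> \<open>For the whole group, \<open>card A + card B \<le> order G + t\<close> would
      force \<open>card B \<le> t\<close>.\<close>
    have "A \<noteq> carrier G" using less.prems 3 by (auto simp: order_def)
    then obtain e where e: "e \<in> carrier G" "A \<inter> (\<lambda>b. b \<otimes> e) ` B \<noteq> {}"
        "\<not> (\<lambda>b. b \<otimes> e) ` B \<subseteq> A"
      using ex_translate_meets_not_subset[of A B] assms(1,2) less.prems 3 by force
    define C where "C = (\<lambda>b. b \<otimes> e) ` B"
    have C: "C \<subseteq> carrier G" using C_def e less.prems by auto
    have cardC: "card C = card B"
      unfolding C_def using e less.prems by (intro card_image) (auto simp: inj_on_def subset_iff)
    define I where "I = A \<inter> C"
    have finA: "finite A" and finC: "finite C" using fin C less.prems by auto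
    have finI: "finite I" using I_def finA by auto
    have I_less: "card I < card B"
      unfolding cardC[symmetric] using e finC C_def I_def by (intro psubset_card_mono) auto
    have I_pos: "card I > 0" using e finI C_def I_def by (auto simp: card_gt_0_iff)
    have Icar: "I \<subseteq> carrier G" using C I_def by auto
    have cU: "card (A \<union> C) + card I = card A + card B"
      using card_Un_Int[OF finA finC] I_def cardC by simp
    have split: "rep_count G A C x = rep_count G (A \<union> C) I x + rep_count G (A - I) (C - I) x" for x
      unfolding I_def using less.prems(1) C finA finC by (rule rep_count_Un_Int)
    have "t * (card A + card B - t) \<le> (\<Sum>x\<in>carrier G. min t (rep_count G A C x))"
    proof (cases "t \<le> card I")
      case True
      \<comment> \<open>By \<open>cU\<close> the transformed pair has the same total size, so its
        bound is the one wanted; by \<open>split\<close> its counts are no larger than those of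
        \<open>A\<close> and \<open>C\<close>.\<close>
      have "t * (card (A \<union> C) + card I - t) \<le> (\<Sum>x\<in>carrier G. min t (rep_count G (A \<union> C) I x))"
      proof (rule less.hyps[OF I_less])
        show "t \<le> card (A \<union> C)" using True cU I_less less.prems by linarith
      qed (use True Icar C less.prems cU in auto)
      also have "\<dots> \<le> (\<Sum>x\<in>carrier G. min t (rep_count G A C x))"
        using split by (intro sum_mono) auto
      finally show ?thesis using cU by simp
    next
      case False
      let ?i = "card I"
      have cA: "card (A - I) = card A - ?i" and cC: "card (C - I) = card B - ?i"
        using card_Diff_subset[OF finI] I_def cardC by auto
      \<comment> \<open>Both sizes and the level drop by \<open>?i\<close>, so the condition on the
        total size holds with \<open>?i\<close> to spare; \<open>I_pos\<close> makes the second set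
        strictly smaller.\<close>
      have "(t - ?i) * (card (A - I) + card (C - I) - (t - ?i))
          \<le> (\<Sum>x\<in>carrier G. min (t - ?i) (rep_count G (A - I) (C - I) x))"
        by (rule less.hyps) (use False less.prems C cA cC I_less I_pos in auto)
      moreover have "(\<Sum>x\<in>carrier G. rep_count G (A \<union> C) I x) = card (A \<union> C) * ?i"
        using sum_rep_count[OF _ Icar assms(1)] less.prems C by simp
      moreover have "(\<Sum>x\<in>carrier G. rep_count G (A \<union> C) I x)
            + (\<Sum>x\<in>carrier G. min (t - ?i) (rep_count G (A - I) (C - I) x))
          \<le> (\<Sum>x\<in>carrier G. min t (rep_count G A C x))"
        unfolding sum.distrib[symmetric]
      proof (rule sum_mono)
        fix x
        have "rep_count G (A \<union> C) I x \<le> ?i"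
          using rep_count_le_card[of "A \<union> C" I x] finI Icar less.prems C by auto
        then show "rep_count G (A \<union> C) I x + min (t - ?i) (rep_count G (A - I) (C - I) x)
            \<le> min t (rep_count G A C x)"
          using split[of x] False by linarith
      qed
      moreover have "t * (card A + card B - t)
          = card (A \<union> C) * ?i + (t - ?i) * (card (A - I) + card (C - I) - (t - ?i))"
      proof -
        \<comment> \<open>Writing \<open>t\<close>, \<open>card A\<close> and \<open>card B\<close>
          as sums removes truncated subtraction and leaves a polynomial identity.\<close>
        have A: "?i \<le> t" "t \<le> card A" "t \<le> card B" using False less.prems by auto
        obtain u where u: "t = ?i + u" using A le_Suc_ex by blast
        obtain v where v: "card A = t + v" using A le_Suc_ex by blast
        obtain w where w: "card B = t + w" using A le_Suc_ex by blast
        have U: "card (A \<union> C) = ?i + 2 * u + v + w" using u v w cU by simp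
        have 1: "card A + card B - t = ?i + u + v + w" using u v w by simp
        have 2: "card (A - I) + card (C - I) - (t - ?i) = u + v + w" "t - ?i = u"
          using u v w cA cC by auto
        show ?thesis unfolding U 1 2(1) unfolding 2(2) using u by (simp add: algebra_simps)
      qed
      ultimately show ?thesis by linarith
    qed
    then show ?thesis
      unfolding C_def using sum_rep_count_translate[OF less.prems(1,2) e(1), of "min t"] by simp
  qed simp
qed

text \<open>If the sizes are too large for \<open>Pollard_aux\<close>, \<open>A\<close> is shrunk to
  \<open>order G + t - card B\<close> elements. Counts can only fall, and the bound for the smaller
  set is exactly \<open>t * order G\<close>.\<close>

theorem Pollard:
  assumes "finite (carrier G)" "prime (order G)" "A \<subseteq> carrier G" "B \<subseteq> carrier G"
    and "t \<le> card A" "t \<le> card B"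
  shows "t * min (order G) (card A + card B - t) \<le> (\<Sum>x\<in>carrier G. min t (rep_count G A B x))"
proof (cases "card A + card B \<le> order G + t")
  case True
  then have "min (order G) (card A + card B - t) = card A + card B - t" by simp
  then show ?thesis using Pollard_aux[OF assms True] by simp
next
  case False
  have fin: "finite A" "finite B" using assms finite_subset by blast+
  have "card B \<le> order G" unfolding order_def using assms card_mono by blast
  obtain A' where A': "A' \<subseteq> A" "card A' = order G + t - card B"
    using obtain_subset_with_card_n[of "order G + t - card B" A] False by (metis le_diff_conv nat_le_linear)
  have "t * (card A' + card B - t) \<le> (\<Sum>x\<in>carrier G. min t (rep_count G A' B x))"
    using assms A' \<open>card B \<le> order G\<close> by (intro Pollard_aux) auto
  also have "\<dots> \<le> (\<Sum>x\<in>carrier G. min t (rep_count G A B x))"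
    by (intro sum_mono min.mono rep_count_mono fin A' order_refl)
  finally show ?thesis using A' False assms(6) \<open>card B \<le> order G\<close> by simp
qed

section \<open>Two-sided bounds at a free level k\<close>

text \<open>Facts \<open>a\<close> and \<open>b\<close> bound the truncated sum on \<open>A\<close>
  and on its complement for the first inequality, \<open>c\<close> and \<open>d\<close> for the
  second. The main terms are arranged as sums to avoid subtraction on \<open>nat\<close>.\<close>

lemma sum_rep_count_inverse_bounds:
  assumes "finite (carrier G)" "prime (order G)" "A \<subseteq> carrier G" "B \<subseteq> carrier G"
    and "k \<le> card B"
  defines "N \<equiv> (\<Sum>x\<in>A. rep_count G B (m_inv G ` B) x)"
  shows "N + k * min (order G) (2 * card B - k) \<le> k * card A + card B ^ 2"
    and "k * min (order G) (2 * card B - k) + k * card A \<le> N + k * order G"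
proof -
  let ?r = "rep_count G B (m_inv G ` B)"
  have fin: "finite A" using assms finite_subset by blast
  have cB: "card (m_inv G ` B) = card B"
    using assms by (intro card_image) (auto simp: inj_on_def subset_iff)
  have invB: "m_inv G ` B \<subseteq> carrier G" using assms by auto
  have P: "k * min (order G) (2 * card B - k) \<le> (\<Sum>x\<in>carrier G. min k (?r x))"
    using Pollard[OF assms(1,2,4) invB, of k] assms(5) cB by (simp add: mult_2)
  have T: "(\<Sum>x\<in>carrier G. ?r x) = card B ^ 2"
    using sum_rep_count[OF assms(4) invB assms(1)] cB by (simp add: power2_eq_square)
  have split: "(\<Sum>x\<in>carrier G. f x) = (\<Sum>x\<in>A. f x) + (\<Sum>x\<in>carrier G - A. f x)"
    for f :: "'a \<Rightarrow> nat"
    using sum.subset_diff[OF assms(3,1), of f] by simp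
  have a: "(\<Sum>x\<in>A. min k (?r x)) \<le> k * card A"
    using sum_bounded_above[of A "\<lambda>x. min k (?r x)" k] by (simp add: mult.commute)
  have b: "(\<Sum>x\<in>carrier G - A. min k (?r x)) \<le> (\<Sum>x\<in>carrier G - A. ?r x)"
    by (intro sum_mono) simp
  have c: "(\<Sum>x\<in>A. min k (?r x)) \<le> N" unfolding N_def by (intro sum_mono) simp
  have "card A \<le> order G" unfolding order_def using assms card_mono by blast
  have d: "(\<Sum>x\<in>carrier G - A. min k (?r x)) + k * card A \<le> k * order G"
  proof -
    have "(\<Sum>x\<in>carrier G - A. min k (?r x)) \<le> k * card (carrier G - A)"
      using sum_bounded_above[of "carrier G - A" "\<lambda>x. min k (?r x)" k] by (simp add: mult.commute)
    also have "\<dots> + k * card A = k * order G"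
      using card_Diff_subset[OF fin assms(3)] \<open>card A \<le> order G\<close>
      by (simp add: order_def add_mult_distrib2[symmetric])
    finally show ?thesis by simp
  qed
  show "N + k * min (order G) (2 * card B - k) \<le> k * card A + card B ^ 2"
    using P T split[of ?r] split[of "\<lambda>x. min k (?r x)"] a b unfolding N_def by linarith
  show "k * min (order G) (2 * card B - k) + k * card A \<le> N + k * order G"
    using P split[of "\<lambda>x. min k (?r x)"] c d by linarith
qed

end

section \<open>Triples in the residue ring and the choice of k\<close>

text \<open>A triple \<open>(a, b, c)\<close> with \<open>c = a \<oplus> b\<close> is the same as a
  representation of \<open>a\<close> by the pair \<open>(c, \<ominus> b)\<close>; triples are
  grouped by \<open>a\<close>.\<close>

lemma (in ring) triple_count_eq_sum_rep_count:
  assumes "finite (carrier R)" "A \<subseteq> carrier R" "B \<subseteq> carrier R"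
  shows "triple_count R A B B
    = (\<Sum>x\<in>A. rep_count (add_monoid R) B (m_inv (add_monoid R) ` B) x)"
proof -
  let ?S = "\<lambda>x. {(c, d) \<in> B \<times> a_inv R ` B. c \<oplus> d = x}"
  have fin: "finite A" "finite B" using assms finite_subset by blast+
  have mem: "a \<in> A \<Longrightarrow> a \<in> carrier R" "b \<in> B \<Longrightarrow> b \<in> carrier R" for a b using assms by auto
  have "bij_betw (\<lambda>(a, b, c). (a, (c, \<ominus> b)))
      {(a, b, a \<oplus> b) | a b. a \<in> A \<and> b \<in> B \<and> a \<oplus> b \<in> B} (Sigma A ?S)"
    by (rule bij_betw_byWitness[where f' = "\<lambda>(a, (c, d)). (a, \<ominus> d, c)"])
      (auto simp: mem a_ac r_neg r_neg1 r_neg2 l_neg)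
  then have "triple_count R A B B = card (Sigma A ?S)"
    unfolding triple_count_def by (rule bij_betw_same_card)
  also have "\<dots> = (\<Sum>x\<in>A. card (?S x))"
    using fin by (intro card_SigmaI ballI finite_rep_pairs) auto
  finally show ?thesis by (simp add: rep_count_def a_inv_def)
qed

text \<open>Here \<open>k\<close> is \<open>m div 2\<close>, where \<open>k * (m - k)\<close> is
  largest over the integers; this is how optimising the level yields the floor.\<close>

lemma floor_quarter_square:
  fixes k m :: int
  assumes "m = 2 * k \<or> m = 2 * k + 1"
  shows "\<lfloor>real_of_int (m\<^sup>2) / 4\<rfloor> = k * (m - k)"
proof -
  have "\<lfloor>real_of_int (m\<^sup>2) / 4\<rfloor> = m\<^sup>2 div 4"
    using floor_divide_of_int_eq[where ?'a = real, of "m\<^sup>2" 4] by simp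
  also have "\<dots> = k * (m - k)"
    using assms by (auto simp: power2_eq_square algebra_simps)
  finally show ?thesis .
qed

theorem theorem6:
  fixes p s t :: int and A B :: "int set"
  assumes "prime p" and "odd p"
    and "1 \<le> s" and "s \<le> p - 1"
    and "1 \<le> t" and "t \<le> p - 1"
    and "A \<subseteq> carrier (residue_ring p)" and "B \<subseteq> carrier (residue_ring p)"
    and "int (card A) = s" and "int (card B) = t"
  shows "lower_bound p s t \<le> int (triple_count (residue_ring p) A B B) \<and>
    int (triple_count (residue_ring p) A B B) \<le> upper_bound p s t"
proof -
  let ?R = "residue_ring p"
  let ?N = "int (triple_count ?R A B B)"
  interpret residues p ?R using assms by unfold_locales auto
  have ord: "order (add_monoid ?R) = nat p"
    by (simp add: order_def res_carrier_eq)
  have fin: "finite (carrier ?R)" by (rule finite)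
  have pos: "0 < p" using assms by linarith
  have bounds: "?N + k * min p (2 * t - k) \<le> k * s + t\<^sup>2"
      "k * min p (2 * t - k) + k * s \<le> ?N + k * p" if k: "0 \<le> k" "k \<le> t" for k
  proof -
    obtain n where n: "k = int n" using k nonneg_int_cases by blast
    have "prime (order (add_monoid ?R))" using assms ord by simp
    note b = comm_group.sum_rep_count_inverse_bounds[OF a_comm_group _ this, of A B n,
        folded triple_count_eq_sum_rep_count[OF fin assms(7,8)]]
    \<comment> \<open>Since \<open>k \<le> t\<close>, the subtraction on \<open>nat\<close> does not
      truncate.\<close>
    have m: "int (min (nat p) (2 * card B - n)) = min p (2 * t - k)"
      using n k assms(10) pos by linarith
    have "int (triple_count ?R A B B + n * min (nat p) (2 * card B - n)) \<le> int (n * card A + card B ^ 2)"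
      using b(1) fin assms n k ord by (simp del: of_nat_add of_nat_mult of_nat_power)
    then show "?N + k * min p (2 * t - k) \<le> k * s + t\<^sup>2"
      using m n assms by simp
    have "int (n * min (nat p) (2 * card B - n) + n * card A) \<le> int (triple_count ?R A B B + n * nat p)"
      using b(2) fin assms n k ord by (simp del: of_nat_add of_nat_mult of_nat_power)
    then show "k * min p (2 * t - k) + k * s \<le> ?N + k * p"
      using m n assms pos by simp
  qed
  have "lower_bound p s t \<le> ?N"
  proof -
    consider "2 * t \<le> p - s + 1" | "p - s + 2 \<le> 2 * t" "2 * t \<le> p + s - 2"
      | "\<not> 2 * t \<le> p - s + 1" "\<not> 2 * t \<le> p + s - 2" by linarith
    then show ?thesis
    proof cases
      case 2
      \<comment> \<open>While \<open>2 * t - k \<le> p\<close>, the second bound reads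
        \<open>k * (m - k) \<le> ?N\<close>, best at half of \<open>m\<close>. The range of
        \<open>t\<close> keeps this \<open>k\<close> admissible.\<close>
      define m where "m = s + 2 * t - p"
      define k where "k = m div 2"
      have k: "0 \<le> k" "k \<le> t" "2 * t - k \<le> p" and mk: "m = 2 * k \<or> m = 2 * k + 1"
        using 2 assms unfolding k_def m_def by linarith+
      from mk have "\<lfloor>real_of_int (m\<^sup>2) / 4\<rfloor> = k * (m - k)"
        by (rule floor_quarter_square)
      also have "\<dots> \<le> ?N"
        using bounds(2)[OF k(1,2)] unfolding min_absorb2[OF k(3)] by (simp add: m_def algebra_simps)
      finally show ?thesis using 2 by (simp add: lower_bound_def m_def)
    next
      case 3
      \<comment> \<open>Half of \<open>m\<close> may now be too small; \<open>k = 2 * t - p\<close>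
        is the level at which both arguments of \<open>min\<close> equal \<open>p\<close>.\<close>
      then have "0 \<le> 2 * t - p" "2 * t - p \<le> t" using assms by linarith+
      from bounds(2)[OF this] show ?thesis
        using 3 by (simp add: lower_bound_def algebra_simps)
    qed (simp add: lower_bound_def)
  qed
  moreover have "?N \<le> upper_bound p s t"
  proof -
    consider "2 * t \<le> s" | "s + 1 \<le> 2 * t" "2 * t \<le> 2 * p - s - 1"
      | "\<not> 2 * t \<le> s" "\<not> 2 * t \<le> 2 * p - s - 1" by linarith
    then show ?thesis
    proof cases
      case 1
      \<comment> \<open>Level 0 gives the trivial bound by all pairs from \<open>B\<close>.\<close>
      then show ?thesis using bounds(1)[of 0] assms by (simp add: upper_bound_def)
    next
      case 2
      \<comment> \<open>Now the first bound reads \<open>?N \<le> t\<^sup>2 - k * (m - k)\<close>,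
        again best at half of \<open>m\<close>.\<close>
      define m where "m = 2 * t - s"
      define k where "k = m div 2"
      have k: "0 \<le> k" "k \<le> t" "2 * t - k \<le> p" and mk: "m = 2 * k \<or> m = 2 * k + 1"
        using 2 assms unfolding k_def m_def by linarith+
      have "?N \<le> t\<^sup>2 - k * (m - k)"
        using bounds(1)[OF k(1,2)] unfolding min_absorb2[OF k(3)] by (simp add: m_def algebra_simps)
      also from mk have "k * (m - k) = \<lfloor>real_of_int (m\<^sup>2) / 4\<rfloor>"
        by (rule floor_quarter_square[symmetric])
      \<comment> \<open>Subtracting a floor from an integer turns it into the ceiling of the stated
        bound.\<close>
      also have "t\<^sup>2 - \<dots> = \<lceil>real_of_int (t\<^sup>2) - real_of_int (m\<^sup>2) / 4\<rceil>"
        by linarith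
      also have "real_of_int (t\<^sup>2) - real_of_int (m\<^sup>2) / 4 = real_of_int (s * (4 * t - s)) / 4"
        by (simp add: m_def power2_eq_square field_simps)
      finally show ?thesis using 2 by (simp add: upper_bound_def)
    next
      case 3
      \<comment> \<open>The same level as in the last lower range; the terms without
        \<open>s\<close> combine to \<open>(p - t)\<^sup>2\<close>.\<close>
      then have "0 \<le> 2 * t - p" "2 * t - p \<le> t" using assms by linarith+
      from bounds(1)[OF this] show ?thesis
        using 3 by (simp add: upper_bound_def power2_eq_square algebra_simps)
    qed
  qed
  ultimately show ?thesis ..
qed

end
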